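(* Write $E\cong\mathcal O(m_1)\oplus\mathcal O(m_2)$ with $m_1\ge m_2$. Then $\mathrm{QPH}_{\mathbb C^*}(E)$ is nonempty if and only if $m_1-m_2\le 2$. Moreover, for a line subbundle $L\subset E$, there exists $(F_1,\dots,F_4,\Phi)\in\mathrm{QPH}(E)$ with $\Phi$ nonzero and nilpotent whose unique $\Phi$-invariant line subbundle $L(\Phi)$ equals $L$ if and only if $2(\deg L+1)\ge \deg E$.
   Context: Fix $z_1\in\mathbb{CP}^1\setminus\{0,1,\infty\}$, set $z_2=0$, $z_3=1$, $z_4=\infty$ and $D=z_1+z_2+z_3+z_4$. Let $E\to\mathbb{CP}^1$ be a holomorphic vector bundle of rank 2 and degree $d$, $E\cong\mathcal O(m_1)\oplus\mathcal O(m_2)$, $m_1\ge m_2$, $m_1+m_2=d$. A quasi-parabolic structure on $E$ is a tuple $(F_1,\dots,F_4)$ of lines $F_i\subset E|_{z_i}$. A (strongly) parabolic Higgs field compatible with it is $\Phi\in H^0(\mathbb{CP}^1,\mathrm{End}(E)\otimes K_{\mathbb{CP}^1}(D))$ such that each residue $\mathrm{Res}_{z_i}\Phi$ is nilpotent with $F_i\subset\ker\mathrm{Res}_{z_i}\Phi$. $\mathrm{QPH}(E)$ is the space of all such tuples $(F_1,\dots,F_4,\Phi)$. The determinant map $\det:\mathrm{QPH}(E)\to H^0(\mathbb{CP}^1,K^2_{\mathbb{CP}^1}(D))\cong\mathbb C$ sends $(F,\Phi)\mapsto\det\Phi$; $\mathrm{QPH}_0(E)=\det^{-1}(0)$ and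 $\mathrm{QPH}_{\mathbb C^*}(E)=\mathrm{QPH}(E)\setminus\mathrm{QPH}_0(E)$. A nonzero nilpotent parabolic Higgs field $\Phi$ preserves a unique line subbundle $L(\Phi)\subset E$ (determined by $\ker\Phi$). *)

theory Defs
  imports "HOL-Analysis.Analysis" "HOL-Computational_Algebra.Polynomial"
begin

text \<open>Concrete model. E = O(m1) + O(m2) on CP^1 with affine coordinate z.
  Sections of O(m) are polynomials of degree at most m (frame at infinity: z^m).
  K(D), D = z1 + 0 + 1 + inf, is trivialised by the section dz/q(z),
  q(z) = z (z - 1) (z - z1).  A parabolic Higgs field Phi in
  H^0(End E (x) K(D)) is Phi = M(z) dz/q(z), where M is a 2x2 matrix of
  polynomials with deg M_ij \<le> m_i - m_j + 2 (M_ij = 0 if this is negative).\<close>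

definition mdeg :: "int \<Rightarrow> int \<Rightarrow> 2 \<Rightarrow> int" where
  "mdeg m1 m2 i = (if i = 1 then m1 else m2)"

definition higgs_field :: "int \<Rightarrow> int \<Rightarrow> complex poly ^2^2 \<Rightarrow> bool" where
  "higgs_field m1 m2 M \<longleftrightarrow>
     (\<forall>i j k. coeff (M$i$j) k \<noteq> 0 \<longrightarrow> int k \<le> mdeg m1 m2 i - mdeg m1 m2 j + 2)"

definition evalM :: "complex poly ^2^2 \<Rightarrow> complex \<Rightarrow> complex^2^2" where
  "evalM M z = (\<chi> i j. poly (M$i$j) z)"

definition qpoly :: "complex \<Rightarrow> complex poly" where
  "qpoly z1 = [:0, 1:] * [:-1, 1:] * [:-z1, 1:]"

text \<open>Marked points z_1 = z1, z_2 = 0, z_3 = 1 (z_4 = infinity).\<close>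
definition zpt :: "complex \<Rightarrow> nat \<Rightarrow> complex" where
  "zpt z1 k = (if k = 1 then z1 else if k = 2 then 0 else 1)"

text \<open>Residue of Phi = M dz/q at a finite marked point a (in the affine frame).\<close>
definition res_fin :: "complex \<Rightarrow> complex poly ^2^2 \<Rightarrow> complex \<Rightarrow> complex^2^2" where
  "res_fin z1 M a = (\<chi> i j. poly (M$i$j) a / poly (pderiv (qpoly z1)) a)"

text \<open>Residue at infinity, in the frame (z^m1, z^m2) of E at infinity, local
  coordinate w = 1/z: Phi = N(w) (-w dw/((1-w)(1-z1 w))) with
  N_ij(w) = w^(m_i - m_j) M_ij(1/w), so the residue is minus the matrix of
  coefficients of z^(m_i - m_j + 2) in M_ij.\<close>
definition res_inf :: "int \<Rightarrow> int \<Rightarrow> complex poly ^2^2 \<Rightarrow> complex^2^2" where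
  "res_inf m1 m2 M = (\<chi> i j. (let e = mdeg m1 m2 i - mdeg m1 m2 j + 2 in
       if e \<ge> 0 then - coeff (M$i$j) (nat e) else 0))"

definition nilpotent_mat :: "complex^2^2 \<Rightarrow> bool" where
  "nilpotent_mat A \<longleftrightarrow> (\<exists>n::nat. (((**) A) ^^ n) (mat 1) = 0)"

definition residue :: "complex \<Rightarrow> int \<Rightarrow> int \<Rightarrow> complex poly ^2^2 \<Rightarrow> nat \<Rightarrow> complex^2^2" where
  "residue z1 m1 m2 M k = (if k = 4 then res_inf m1 m2 M else res_fin z1 M (zpt z1 k))"

text \<open>QPH(E): lines F_k \<subseteq> E|_{z_k} (given by nonzero spanning vectors F k, k = 1..4,
  in the fibre frames above) and a strongly parabolic Higgs field compatible with them.\<close>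
definition QPH :: "complex \<Rightarrow> int \<Rightarrow> int \<Rightarrow> (nat \<Rightarrow> complex^2) \<Rightarrow> complex poly ^2^2 \<Rightarrow> bool" where
  "QPH z1 m1 m2 F M \<longleftrightarrow> higgs_field m1 m2 M \<and>
     (\<forall>k\<in>{1..4}. F k \<noteq> 0 \<and> nilpotent_mat (residue z1 m1 m2 M k)
                 \<and> residue z1 m1 m2 M k *v F k = 0)"

text \<open>det Phi = det(M(z)) (dz/q)^2; it is nonzero iff det M is not identically 0.\<close>
definition det_nonzero :: "complex poly ^2^2 \<Rightarrow> bool" where
  "det_nonzero M \<longleftrightarrow> (\<exists>z. det (evalM M z) \<noteq> 0)"

definition QPH_Cstar_nonempty :: "complex \<Rightarrow> int \<Rightarrow> int \<Rightarrow> bool" where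
  "QPH_Cstar_nonempty z1 m1 m2 \<longleftrightarrow> (\<exists>F M. QPH z1 m1 m2 F M \<and> det_nonzero M)"

text \<open>A line subbundle L \<cong> O(l) of E, given by an injection O(l) \<rightarrow> E, i.e. a pair of
  polynomials (p1, p2) with deg p_i \<le> m_i - l, nowhere vanishing on CP^1
  (no common root in C, and not both coefficients of z^(m_i - l) zero, i.e.
  nonvanishing at infinity).  deg L = l.\<close>
definition line_subbundle :: "int \<Rightarrow> int \<Rightarrow> int \<Rightarrow> complex poly \<Rightarrow> complex poly \<Rightarrow> bool" where
  "line_subbundle m1 m2 l p1 p2 \<longleftrightarrow>
     (\<forall>k. coeff p1 k \<noteq> 0 \<longrightarrow> int k \<le> m1 - l) \<and>
     (\<forall>k. coeff p2 k \<noteq> 0 \<longrightarrow> int k \<le> m2 - l) \<and>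
     (\<forall>z. poly p1 z \<noteq> 0 \<or> poly p2 z \<noteq> 0) \<and>
     ((m1 - l \<ge> 0 \<and> coeff p1 (nat (m1 - l)) \<noteq> 0) \<or> (m2 - l \<ge> 0 \<and> coeff p2 (nat (m2 - l)) \<noteq> 0))"

text \<open>Phi is nilpotent (pointwise, as an endomorphism field).\<close>
definition nilpotent_field :: "complex poly ^2^2 \<Rightarrow> bool" where
  "nilpotent_field M \<longleftrightarrow> (\<forall>z. nilpotent_mat (evalM M z))"

text \<open>L(Phi) = L: the line subbundle L is the kernel of Phi (Phi annihilates L;
  for nonzero nilpotent Phi its kernel is a line subbundle, so L \<subseteq> ker Phi
  forces equality).\<close>
definition invariant_line_is :: "complex poly ^2^2 \<Rightarrow> complex poly \<Rightarrow> complex poly \<Rightarrow> bool" where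
  "invariant_line_is M p1 p2 \<longleftrightarrow> (\<forall>z. evalM M z *v vector [poly p1 z, poly p2 z] = 0)"

end

(*
  In the frames of E over C and at infinity a parabolic Higgs field is a polynomial matrix M
  with deg M_ij <= m_i - m_j + 2, and a 2x2 matrix is nilpotent iff its trace and determinant
  vanish.  If m1 - m2 > 2 then M_21 = 0, so every residue is upper triangular; nilpotency then
  makes the quadratic diagonal entries vanish at 0 and 1 and kills their z^2-coefficients
  (residue at infinity), hence det M = 0.  For m1 - m2 <= 2 an antidiagonal M whose two entries
  have product vanishing at the marked points works.

  If a nonzero nilpotent M kills L = (p1, p2), then trace M = 0 and coprimality of p1, p2 give
  p1^2 | M_12 and p2^2 | M_21, the relevant entry being nonzero; comparing degrees for a
  component p_i of full degree m_i - l gives 2 (l + 1) >= m1 + m2.  Conversely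
  M = z^s (p1, p2)^T (-p2, p1) with s = 2 (l + 1) - m1 - m2 is a Higgs field, and its residue at
  infinity has the same rank-one nilpotent shape, built from the top coefficients of p1, p2.
*)

theory Submission
  imports Defs "HOL-Computational_Algebra.Polynomial_Factorial"
    "HOL-Computational_Algebra.Fundamental_Theorem_Algebra" "HOL-Computational_Algebra.Field_as_Ring"
begin

text \<open>Cayley-Hamilton for 2x2 matrices.\<close>

lemma mat2_square_nth:
  fixes A :: "'a::comm_ring_1^2^2"
  shows "(A ** A) $ i $ j = trace A * A$i$j - (if i = j then det A else 0)"
  using exhaust_2[of i] exhaust_2[of j]
  by (auto simp: matrix_matrix_mult_def sum_2 trace_def det_2 algebra_simps)

lemma nilpotent_mat_iff_trace_det:
  fixes A :: "complex^2^2"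
  shows "nilpotent_mat A \<longleftrightarrow> trace A = 0 \<and> det A = 0"
proof
  assume "nilpotent_mat A"
  then obtain n where n: "(((**) A) ^^ n) (mat 1) = 0"
    unfolding nilpotent_mat_def by blast
  have "(mat 1 :: complex^2^2) $ 1 $ 1 \<noteq> 0"
    by (simp add: mat_def)
  then have "mat 1 \<noteq> (0::complex^2^2)"
    by auto
  then obtain k where k: "n = Suc k"
    using n by (cases n) auto
  have "det ((((**) A) ^^ n) (mat 1)) = det A ^ n"
    by (induction n) (simp_all add: det_mul det_I)
  moreover have "det (0::complex^2^2) = 0"
    by (simp add: det_2)
  ultimately have det0: "det A = 0"
    using n k by auto
  have powers: "(((**) A) ^^ Suc j) (mat 1) $ r $ s = trace A ^ j * A$r$s" for j r s
  proof (induction j arbitrary: r s)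
    case (Suc j)
    have "(((**) A) ^^ Suc (Suc j)) (mat 1) $ r $ s
        = (\<Sum>t\<in>UNIV. A$r$t * (((**) A) ^^ Suc j) (mat 1) $ t $ s)"
      by (simp only: funpow.simps comp_apply matrix_matrix_mult_def vec_lambda_beta)
    also have "\<dots> = trace A ^ j * (A ** A) $ r $ s"
      unfolding Suc.IH by (simp add: matrix_matrix_mult_def sum_distrib_left algebra_simps)
    finally show ?case
      by (simp add: mat2_square_nth det0)
  qed simp
  have "trace A = 0"
  proof (rule ccontr)
    assume "trace A \<noteq> 0"
    then have "A = 0"
      using powers[of k] n k by (simp add: vec_eq_iff)
    then show False
      using \<open>trace A \<noteq> 0\<close> by (simp add: trace_def)
  qed
  then show "trace A = 0 \<and> det A = 0"
    using det0 by simp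
next
  assume "trace A = 0 \<and> det A = 0"
  then have "A ** A = 0"
    by (simp add: vec_eq_iff mat2_square_nth)
  then have "(((**) A) ^^ 2) (mat 1) = 0"
    by (simp add: numeral_2_eq_2)
  then show "nilpotent_mat A"
    unfolding nilpotent_mat_def by blast
qed

lemma ex_kernel_vector_if_det_eq_0:
  fixes A :: "'a::field^'n^'n"
  assumes "det A = 0"
  shows "\<exists>x. x \<noteq> 0 \<and> A *v x = 0"
proof -
  have "\<not> invertible A"
    using assms by (simp add: invertible_det_nz)
  then show ?thesis
    by (metis invertible_left_inverse matrix_left_invertible_ker)
qed

text \<open>Polynomials of degree at most \<open>n\<close>, i.e. sections of \<open>O(n)\<close>; only \<open>0\<close> if \<open>n < 0\<close>.\<close>

definition degree_at_most :: "'a::zero poly \<Rightarrow> int \<Rightarrow> bool" where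
  "degree_at_most p n \<longleftrightarrow> (\<forall>k. coeff p k \<noteq> 0 \<longrightarrow> int k \<le> n)"

lemma degree_at_most_iff: "degree_at_most p n \<longleftrightarrow> p = 0 \<or> int (degree p) \<le> n"
  unfolding degree_at_most_def
  by (metis coeff_0 le_degree leading_coeff_0_iff of_nat_le_iff order_trans)

lemma degree_at_most_negative: "degree_at_most p n \<Longrightarrow> n < 0 \<Longrightarrow> p = 0"
  by (auto simp: degree_at_most_iff)

lemma degree_at_most_uminus [simp]: "degree_at_most (- p) n \<longleftrightarrow> degree_at_most p n"
  by (simp add: degree_at_most_def)

lemma degree_at_most_mult:
  fixes p q :: "'a::comm_semiring_0 poly"
  assumes "degree_at_most p a" "degree_at_most q b"
  shows "degree_at_most (p * q) (a + b)"
  using assms degree_mult_le[of p q] unfolding degree_at_most_iff by fastforce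

lemma coeff_mult_at_degree_bounds:
  fixes p q :: "'a::comm_semiring_0 poly"
  assumes "degree p \<le> a" "degree q \<le> b"
  shows "coeff (p * q) (a + b) = coeff p a * coeff q b"
proof -
  have "coeff p i * coeff q (a + b - i) = 0" if "i \<noteq> a" for i
    using that assms by (cases "i < a") (auto simp: coeff_eq_0)
  then show ?thesis
    by (simp add: coeff_mult sum.remove[of _ a])
qed

lemma coeff_mult_at_int_degree_bounds:
  fixes p q :: "'a::comm_semiring_0 poly"
  assumes "degree_at_most p a" "degree_at_most q b"
  shows "coeff (p * q) (nat (a + b)) = coeff p (nat a) * coeff q (nat b)"
proof (cases "a < 0 \<or> b < 0")
  case True
  then show ?thesis
    using assms degree_at_most_negative by fastforce
next
  case False
  then have "nat (a + b) = nat a + nat b"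
    by (simp add: nat_add_distrib)
  moreover have "degree p \<le> nat a" "degree q \<le> nat b"
    using assms False by (auto simp: degree_at_most_iff)
  ultimately show ?thesis
    by (simp add: coeff_mult_at_degree_bounds)
qed

lemma coprime_if_no_common_root:
  fixes p q :: "complex poly"
  assumes "\<forall>z. poly p z \<noteq> 0 \<or> poly q z \<noteq> 0"
  shows "coprime p q"
proof (rule ccontr)
  assume "\<not> coprime p q"
  then have "\<not> is_unit (gcd p q)"
    by (metis is_unit_gcd)
  then obtain z where "poly (gcd p q) z = 0"
    using fundamental_theorem_of_algebra_alt[of "gcd p q"] is_unit_triv by fastforce
  then have "poly p z = 0" "poly q z = 0"
    by (metis dvdE gcd_dvd1 gcd_dvd2 mult_eq_0_iff poly_mult)+
  then show False
    using assms by blast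
qed

lemma square_dvd_if_in_kernel:
  fixes a b c p q :: "'a::factorial_ring_gcd"
  assumes "coprime p q" "p \<noteq> 0" "a * p + b * q = 0" "c * p = a * q"
  shows "p\<^sup>2 dvd b"
proof -
  have "p dvd b * q"
    using assms(3) by (metis add.commute add_eq_0_iff dvd_minus_iff dvd_triv_right)
  then obtain h where b: "b = p * h"
    using assms(1) by (auto simp: coprime_dvd_mult_left_iff elim: dvdE)
  have "p * (a + h * q) = 0"
    using assms(3) by (simp add: b algebra_simps)
  then have "a = - (h * q)"
    using assms(2) by (simp add: eq_neg_iff_add_eq_0)
  then have "p dvd h * q\<^sup>2"
    using assms(4) by (metis dvd_minus_iff dvd_triv_right mult.assoc mult_minus_left power2_eq_square)
  then have "p dvd h"
    using assms(1) by (simp add: coprime_dvd_mult_left_iff)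
  then show ?thesis
    by (simp add: b power2_eq_square)
qed

lemma off_diagonal_degree_bound:
  fixes a b c p q :: "complex poly"
  assumes "coprime p q" "p \<noteq> 0" "a * p + b * q = 0" "c * p = a * q"
    and "a \<noteq> 0 \<or> b \<noteq> 0 \<or> c \<noteq> 0" "degree_at_most b n"
  shows "2 * int (degree p) \<le> n"
proof -
  have "b \<noteq> 0"
    using assms(2-5) by auto
  moreover have "p\<^sup>2 dvd b"
    using assms(1-4) by (rule square_dvd_if_in_kernel)
  ultimately have "degree (p\<^sup>2) \<le> degree b"
    by (rule dvd_imp_degree_le[rotated])
  then show ?thesis
    using assms(6) \<open>b \<noteq> 0\<close> by (simp add: degree_at_most_iff degree_power_eq assms(2))
qed

lemma mdeg_simps [simp]: "mdeg m1 m2 1 = m1" "mdeg m1 m2 2 = m2"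
  by (simp_all add: mdeg_def)

lemma higgs_field_iff:
  "higgs_field m1 m2 M \<longleftrightarrow>
     degree_at_most (M$1$1) 2 \<and> degree_at_most (M$1$2) (m1 - m2 + 2) \<and>
     degree_at_most (M$2$1) (m2 - m1 + 2) \<and> degree_at_most (M$2$2) 2"
proof -
  have "higgs_field m1 m2 M \<longleftrightarrow>
      (\<forall>i j. degree_at_most (M$i$j) (mdeg m1 m2 i - mdeg m1 m2 j + 2))"
    by (simp add: higgs_field_def degree_at_most_def)
  then show ?thesis
    by (simp add: forall_2)
qed

lemma res_inf_nth:
  assumes "higgs_field m1 m2 M"
  shows "res_inf m1 m2 M $ i $ j = - coeff (M$i$j) (nat (mdeg m1 m2 i - mdeg m1 m2 j + 2))"
proof -
  have "degree_at_most (M$i$j) (mdeg m1 m2 i - mdeg m1 m2 j + 2)"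
    using assms by (simp add: higgs_field_def degree_at_most_def)
  then show ?thesis
    by (auto simp: res_inf_def Let_def dest: degree_at_most_negative)
qed

lemma nilpotent_res_fin_iff:
  assumes "poly (pderiv (qpoly z1)) a \<noteq> 0"
  shows "nilpotent_mat (res_fin z1 M a) \<longleftrightarrow> nilpotent_mat (evalM M a)"
proof -
  let ?c = "poly (pderiv (qpoly z1)) a"
  have "trace (res_fin z1 M a) = trace (evalM M a) / ?c"
    by (simp add: trace_def sum_2 res_fin_def evalM_def add_divide_distrib)
  moreover have "det (res_fin z1 M a) = det (evalM M a) / ?c\<^sup>2"
    by (simp add: det_2 res_fin_def evalM_def diff_divide_distrib power2_eq_square)
  ultimately show ?thesis
    using assms by (simp add: nilpotent_mat_iff_trace_det)
qed

lemma qpoly_eq: "qpoly z1 = [:0, z1, -(1 + z1), 1:]"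
  by (simp add: qpoly_def algebra_simps)

lemma poly_qpoly_zpt: "k \<in> {1, 2, 3} \<Longrightarrow> poly (qpoly z1) (zpt z1 k) = 0"
  by (auto simp: qpoly_def zpt_def)

lemma poly_pderiv_qpoly_zpt:
  assumes "z1 \<noteq> 0" "z1 \<noteq> 1" "k \<in> {1, 2, 3}"
  shows "poly (pderiv (qpoly z1)) (zpt z1 k) \<noteq> 0"
  using assms by (auto simp: qpoly_eq zpt_def pderiv_pCons algebra_simps power2_eq_square)

lemma ex_QPH_iff:
  assumes "z1 \<noteq> 0" "z1 \<noteq> 1"
  shows "(\<exists>F. QPH z1 m1 m2 F M) \<longleftrightarrow>
           higgs_field m1 m2 M \<and> (\<forall>k\<in>{1, 2, 3}. nilpotent_mat (evalM M (zpt z1 k))) \<and>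
           nilpotent_mat (res_inf m1 m2 M)"
proof -
  have "(\<exists>F. QPH z1 m1 m2 F M) \<longleftrightarrow>
      higgs_field m1 m2 M \<and> (\<forall>k\<in>{1..4}. nilpotent_mat (residue z1 m1 m2 M k))"
  proof
    assume "higgs_field m1 m2 M \<and> (\<forall>k\<in>{1..4}. nilpotent_mat (residue z1 m1 m2 M k))"
    moreover from this have "\<forall>k\<in>{1..4}. \<exists>x. x \<noteq> 0 \<and> residue z1 m1 m2 M k *v x = 0"
      by (simp add: nilpotent_mat_iff_trace_det ex_kernel_vector_if_det_eq_0)
    then obtain F where "\<forall>k\<in>{1..4}. F k \<noteq> 0 \<and> residue z1 m1 m2 M k *v F k = 0"
      by metis
    ultimately show "\<exists>F. QPH z1 m1 m2 F M"
      unfolding QPH_def by blast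
  qed (auto simp: QPH_def)
  moreover have "{1..4} = insert 4 {1, 2, 3::nat}"
    by auto
  ultimately show ?thesis
    using assms poly_pderiv_qpoly_zpt
    by (auto simp: residue_def nilpotent_res_fin_iff)
qed

lemma upper_triangular_nilpotent_diag:
  "nilpotent_mat A \<Longrightarrow> A$2$1 = 0 \<Longrightarrow> A$1$1 = 0 \<and> A$2$2 = 0"
  by (auto simp: nilpotent_mat_iff_trace_det trace_def sum_2 det_2 add_eq_0_iff)

lemma not_det_nonzero_if_gap_gt_2:
  assumes "z1 \<noteq> 0" "z1 \<noteq> 1" "m1 - m2 > 2" "QPH z1 m1 m2 F M"
  shows "\<not> det_nonzero M"
proof -
  have hf: "higgs_field m1 m2 M"
    and fin: "\<forall>k\<in>{1, 2, 3}. nilpotent_mat (evalM M (zpt z1 k))"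
    and inf: "nilpotent_mat (res_inf m1 m2 M)"
    using assms ex_QPH_iff by blast+
  have M21: "M$2$1 = 0"
    using hf assms(3) by (intro degree_at_most_negative[of _ "m2 - m1 + 2"]) (auto simp: higgs_field_iff)
  have vanishing: "p = 0"
    if "degree_at_most p 2" "coeff p 2 = 0" "poly p 0 = 0" "poly p 1 = 0" for p :: "complex poly"
    using poly_eqI_degree_lead_coeff[of p 2 0 "{0, 1}"] that by (auto simp: degree_at_most_iff)
  have "poly (M$i$i) 0 = 0" "poly (M$i$i) 1 = 0" for i
    using fin upper_triangular_nilpotent_diag[of "evalM M _"] exhaust_2[of i] M21
    by (auto simp: evalM_def zpt_def)
  moreover have "coeff (M$i$i) 2 = 0" for i
    using upper_triangular_nilpotent_diag[OF inf] exhaust_2[of i] M21 hf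
    by (auto simp: res_inf_nth)
  moreover have "degree_at_most (M$i$i) 2" for i
    using hf exhaust_2[of i] by (auto simp: higgs_field_iff)
  ultimately have "M$1$1 = 0" "M$2$2 = 0"
    using vanishing by blast+
  then show ?thesis
    by (simp add: det_nonzero_def det_2 evalM_def M21)
qed

definition antidiag :: "'a::zero \<Rightarrow> 'a \<Rightarrow> 'a^2^2" where
  "antidiag b c = vector [vector [0, b], vector [c, 0]]"

lemma antidiag_nth [simp]:
  "antidiag b c $1$1 = 0" "antidiag b c $1$2 = b" "antidiag b c $2$1 = c" "antidiag b c $2$2 = 0"
  by (simp_all add: antidiag_def)

lemma nilpotent_antidiag_iff: "nilpotent_mat (antidiag b c) \<longleftrightarrow> b * c = 0"
  by (simp add: nilpotent_mat_iff_trace_det trace_def sum_2 det_2)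

lemma evalM_antidiag: "evalM (antidiag b c) z = antidiag (poly b z) (poly c z)"
  by (simp add: evalM_def vec_eq_iff forall_2)

lemma det_nonzero_antidiag:
  assumes "b \<noteq> 0" "c \<noteq> 0"
  shows "det_nonzero (antidiag b c)"
proof -
  obtain z where "poly (b * c) z \<noteq> 0"
    using assms poly_all_0_iff_0 by (metis mult_eq_0_iff)
  then show ?thesis
    by (auto simp: det_nonzero_def evalM_antidiag det_2)
qed

lemma ex_QPH_antidiag:
  assumes "z1 \<noteq> 0" "z1 \<noteq> 1" "higgs_field m1 m2 (antidiag b c)"
    and "\<forall>k\<in>{1, 2, 3}. poly (b * c) (zpt z1 k) = 0"
    and "coeff b (nat (m1 - m2 + 2)) * coeff c (nat (m2 - m1 + 2)) = 0"
  shows "\<exists>F. QPH z1 m1 m2 F (antidiag b c)"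
proof -
  have "res_inf m1 m2 (antidiag b c) =
      antidiag (- coeff b (nat (m1 - m2 + 2))) (- coeff c (nat (m2 - m1 + 2)))"
    using assms(3) by (simp add: vec_eq_iff forall_2 res_inf_nth)
  then show ?thesis
    using assms by (simp add: ex_QPH_iff evalM_antidiag nilpotent_antidiag_iff)
qed

lemma QPH_Cstar_nonempty_if_gap_le_2:
  assumes "z1 \<noteq> 0" "z1 \<noteq> 1" "m2 \<le> m1" "m1 - m2 \<le> 2"
  shows "QPH_Cstar_nonempty z1 m1 m2"
proof (cases "m1 = m2")
  case True
  let ?b = "[:0, -1, 1:]" and ?c = "[:-z1, 1:]"
  have "\<exists>F. QPH z1 m1 m2 F (antidiag ?b ?c)"
    using assms True
    by (intro ex_QPH_antidiag) (auto simp: higgs_field_iff degree_at_most_iff zpt_def eval_nat_numeral)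
  moreover have "det_nonzero (antidiag ?b ?c)"
    by (rule det_nonzero_antidiag) simp_all
  ultimately show ?thesis
    unfolding QPH_Cstar_nonempty_def by blast
next
  case False
  then consider "m1 - m2 = 1" | "m1 - m2 = 2"
    using assms by linarith
  then have "coeff (qpoly z1) (nat (m1 - m2 + 2)) * coeff 1 (nat (m2 - m1 + 2)) = 0"
    by cases (simp_all add: qpoly_eq numeral_eq_Suc)
  then have "\<exists>F. QPH z1 m1 m2 F (antidiag (qpoly z1) 1)"
    using assms False poly_qpoly_zpt
    by (intro ex_QPH_antidiag) (auto simp: higgs_field_iff degree_at_most_iff qpoly_eq)
  moreover have "det_nonzero (antidiag (qpoly z1) 1)"
    by (rule det_nonzero_antidiag) (simp_all add: qpoly_eq)
  ultimately show ?thesis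
    unfolding QPH_Cstar_nonempty_def by blast
qed

text \<open>The matrix \<open>w (x, y)\<^sup>T (-y, x)\<close>: its kernel and its image are both spanned by \<open>(x, y)\<close>.\<close>

definition rank_one_nilpotent :: "'a::comm_ring \<Rightarrow> 'a \<Rightarrow> 'a \<Rightarrow> 'a^2^2" where
  "rank_one_nilpotent w x y = vector [vector [-(w * x * y), w * x * x], vector [-(w * y * y), w * x * y]]"

lemma rank_one_nilpotent_nth [simp]:
  "rank_one_nilpotent w x y $1$1 = -(w * x * y)" "rank_one_nilpotent w x y $1$2 = w * x * x"
  "rank_one_nilpotent w x y $2$1 = -(w * y * y)" "rank_one_nilpotent w x y $2$2 = w * x * y"
  by (simp_all add: rank_one_nilpotent_def)

lemma nilpotent_rank_one_nilpotent: "nilpotent_mat (rank_one_nilpotent w x y)"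
  by (simp add: nilpotent_mat_iff_trace_det trace_def sum_2 det_2 algebra_simps)

lemma rank_one_nilpotent_kernel: "rank_one_nilpotent w x y *v vector [x, y] = 0"
  by (simp add: vec_eq_iff forall_2 matrix_vector_mult_def sum_2 algebra_simps)

lemma evalM_rank_one_nilpotent:
  "evalM (rank_one_nilpotent w p q) z = rank_one_nilpotent (poly w z) (poly p z) (poly q z)"
  by (simp add: evalM_def vec_eq_iff forall_2)

lemma line_subbundle_degrees:
  assumes "line_subbundle m1 m2 l p1 p2"
  shows "degree_at_most p1 (m1 - l)" "degree_at_most p2 (m2 - l)"
  using assms by (simp_all add: line_subbundle_def degree_at_most_def)

lemma line_subbundle_full_degree:
  assumes "line_subbundle m1 m2 l p1 p2"
  obtains "p1 \<noteq> 0" "int (degree p1) = m1 - l" | "p2 \<noteq> 0" "int (degree p2) = m2 - l"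
proof -
  have "p \<noteq> 0 \<and> int (degree p) = n"
    if "degree_at_most p n" "0 \<le> n" "coeff p (nat n) \<noteq> 0" for p :: "complex poly" and n
    using that le_degree[of p "nat n"] by (auto simp: degree_at_most_iff)
  then show ?thesis
    using assms line_subbundle_degrees[OF assms] that unfolding line_subbundle_def by blast
qed

lemma line_bound_if_nilpotent_kills_line:
  assumes "line_subbundle m1 m2 l p1 p2" "higgs_field m1 m2 M" "M \<noteq> 0"
    and "nilpotent_field M" "invariant_line_is M p1 p2"
  shows "m1 + m2 \<le> 2 * (l + 1)"
proof -
  have "poly (M$1$1 + M$2$2) z = 0" for z
    using assms(4) unfolding nilpotent_field_def
    by (simp add: nilpotent_mat_iff_trace_det trace_def sum_2 evalM_def)
  then have "M$1$1 + M$2$2 = 0"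
    using poly_all_0_iff_0 by blast
  then have M22: "M$2$2 = - M$1$1"
    by (simp add: eq_neg_iff_add_eq_0 add.commute)
  have "(evalM M z *v vector [poly p1 z, poly p2 z]) $ i = 0" for z i
    using assms(5) by (simp add: invariant_line_is_def)
  then have "poly (M$1$1 * p1 + M$1$2 * p2) z = 0" "poly (M$2$1 * p1 + M$2$2 * p2) z = 0" for z
    by (simp_all add: matrix_vector_mult_def sum_2 evalM_def)
  then have ker1: "M$1$1 * p1 + M$1$2 * p2 = 0" and "M$2$1 * p1 + M$2$2 * p2 = 0"
    using poly_all_0_iff_0 by blast+
  then have ker2: "M$2$1 * p1 = M$1$1 * p2"
    by (simp add: M22)
  have nonzero: "M$1$1 \<noteq> 0 \<or> M$1$2 \<noteq> 0 \<or> M$2$1 \<noteq> 0"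
    using assms(3) M22 by (auto simp: vec_eq_iff forall_2)
  have coprime: "coprime p1 p2"
    using assms(1) by (simp add: line_subbundle_def coprime_if_no_common_root)
  have off_diagonal: "degree_at_most (M$1$2) (m1 - m2 + 2)" "degree_at_most (M$2$1) (m2 - m1 + 2)"
    using assms(2) by (simp_all add: higgs_field_iff)
  from assms(1) show ?thesis
  proof (cases rule: line_subbundle_full_degree)
    case 1
    then show ?thesis
      using off_diagonal_degree_bound[OF coprime _ ker1 ker2 nonzero off_diagonal(1)] by simp
  next
    case 2
    have "M$2$2 * p2 + M$2$1 * p1 = 0" "M$1$2 * p2 = M$2$2 * p1"
      using ker1 ker2 by (simp_all add: M22 add_eq_0_iff)
    moreover have "M$2$2 \<noteq> 0 \<or> M$2$1 \<noteq> 0 \<or> M$1$2 \<noteq> 0"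
      using nonzero M22 by auto
    moreover have "coprime p2 p1"
      using coprime by (simp add: coprime_commute)
    ultimately have "2 * int (degree p2) \<le> m2 - m1 + 2"
      using off_diagonal_degree_bound[of p2 p1 "M$2$2" "M$2$1" "M$1$2"] off_diagonal(2) 2(1)
      by blast
    with 2(2) show ?thesis
      by simp
  qed
qed

lemma ex_nilpotent_QPH_killing_line:
  assumes "z1 \<noteq> 0" "z1 \<noteq> 1" "line_subbundle m1 m2 l p1 p2" "m1 + m2 \<le> 2 * (l + 1)"
  shows "\<exists>F M. QPH z1 m1 m2 F M \<and> M \<noteq> 0 \<and> nilpotent_field M \<and> invariant_line_is M p1 p2"
proof -
  define s where "s = 2 * (l + 1) - m1 - m2"
  define w :: "complex poly" where "w = monom 1 (nat s)"
  define M where "M = rank_one_nilpotent w p1 p2"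
  have d1: "degree_at_most p1 (m1 - l)" and d2: "degree_at_most p2 (m2 - l)"
    using line_subbundle_degrees[OF assms(3)] by auto
  have dw: "degree_at_most w s"
    using assms(4) by (simp add: w_def s_def degree_at_most_iff degree_monom_eq)
  have deg: "degree_at_most (w * p * q) e"
    if "degree_at_most p a" "degree_at_most q b" "e = s + a + b" for p q a b e
    using degree_at_most_mult[OF degree_at_most_mult[OF dw that(1)] that(2)] that(3) by simp
  have coeff_top: "coeff (w * p * q) (nat e) = coeff p (nat a) * coeff q (nat b)"
    if "degree_at_most p a" "degree_at_most q b" "e = s + a + b" for p q a b e
  proof -
    have "coeff w (nat s) = 1"
      by (simp add: w_def)
    then show ?thesis
      using that coeff_mult_at_int_degree_bounds[OF degree_at_most_mult[OF dw that(1)] that(2)]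
        coeff_mult_at_int_degree_bounds[OF dw that(1)] by simp
  qed
  have hf: "higgs_field m1 m2 M"
    unfolding higgs_field_iff M_def
    by (auto intro: deg[OF d1 d2] deg[OF d1 d1] deg[OF d2 d2] simp: s_def)
  have "coeff (w * p1 * p2) 2 = coeff p1 (nat (m1 - l)) * coeff p2 (nat (m2 - l))"
    using coeff_top[OF d1 d2, of 2] by (simp add: s_def)
  moreover have "coeff (w * p1 * p1) (nat (m1 - m2 + 2)) = coeff p1 (nat (m1 - l)) ^ 2"
    using coeff_top[OF d1 d1, of "m1 - m2 + 2"] by (simp add: s_def power2_eq_square)
  moreover have "coeff (w * p2 * p2) (nat (m2 - m1 + 2)) = coeff p2 (nat (m2 - l)) ^ 2"
    using coeff_top[OF d2 d2, of "m2 - m1 + 2"] by (simp add: s_def power2_eq_square)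
  ultimately have "res_inf m1 m2 M =
      rank_one_nilpotent (-1) (coeff p1 (nat (m1 - l))) (coeff p2 (nat (m2 - l)))"
    using hf by (simp add: vec_eq_iff forall_2 res_inf_nth M_def power2_eq_square)
  then have "\<exists>F. QPH z1 m1 m2 F M"
    using assms(1,2) hf
    by (simp add: ex_QPH_iff M_def evalM_rank_one_nilpotent nilpotent_rank_one_nilpotent)
  moreover have "M \<noteq> 0"
  proof
    assume "M = 0"
    then have "w * p1 * p1 = 0" "w * p2 * p2 = 0"
      unfolding M_def by (metis rank_one_nilpotent_nth(2,3) zero_index neg_equal_0_iff_equal)+
    then have "p1 = 0" "p2 = 0"
      by (auto simp: w_def)
    then show False
      using assms(3) by (simp add: line_subbundle_def)
  qed
  moreover have "nilpotent_field M"
    by (simp add: nilpotent_field_def M_def evalM_rank_one_nilpotent nilpotent_rank_one_nilpotent)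
  moreover have "invariant_line_is M p1 p2"
    by (simp add: invariant_line_is_def M_def evalM_rank_one_nilpotent rank_one_nilpotent_kernel)
  ultimately show ?thesis
    by blast
qed

theorem lemma4p3:
  fixes z1 :: complex and m1 m2 :: int
  assumes "z1 \<noteq> 0" and "z1 \<noteq> 1" and "m1 \<ge> m2"
  shows "(QPH_Cstar_nonempty z1 m1 m2 \<longleftrightarrow> m1 - m2 \<le> 2) \<and>
         (\<forall>l p1 p2. line_subbundle m1 m2 l p1 p2 \<longrightarrow>
            ((\<exists>F M. QPH z1 m1 m2 F M \<and> M \<noteq> 0 \<and> nilpotent_field M \<and>
                     invariant_line_is M p1 p2)
             \<longleftrightarrow> 2 * (l + 1) \<ge> m1 + m2))"
proof (intro conjI allI impI iffI)
  show "m1 - m2 \<le> 2" if "QPH_Cstar_nonempty z1 m1 m2"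
    using that not_det_nonzero_if_gap_gt_2[OF assms(1,2)]
    unfolding QPH_Cstar_nonempty_def by force
  show "QPH_Cstar_nonempty z1 m1 m2" if "m1 - m2 \<le> 2"
    using QPH_Cstar_nonempty_if_gap_le_2 assms that by blast
  fix l p1 p2
  assume line: "line_subbundle m1 m2 l p1 p2"
  show "2 * (l + 1) \<ge> m1 + m2"
    if "\<exists>F M. QPH z1 m1 m2 F M \<and> M \<noteq> 0 \<and> nilpotent_field M \<and> invariant_line_is M p1 p2"
    using that line_bound_if_nilpotent_kills_line[OF line] by (auto simp: QPH_def)
  show "\<exists>F M. QPH z1 m1 m2 F M \<and> M \<noteq> 0 \<and> nilpotent_field M \<and> invariant_line_is M p1 p2"
    if "2 * (l + 1) \<ge> m1 + m2"
    using ex_nilpotent_QPH_killing_line[OF assms(1,2) line that] .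
qed

end
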